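(* Let $v: G \rightarrow [0,\infty[$ be a weight on a planar domain $G$. Assume that for each compact set $K \subset G$ there is a compact set $L$ such that $K \subset L \subset G$ and a number $\alpha >0$ such that $$\partial L \subset \overline{ \{z \in G : v(z) \geq \alpha \} }.$$ Then $H^\infty_v(G)$ is a Banach space.
   Context: A planar domain is a (nonempty) open connected subset $G$ of $\mathbb{C}$. A weight on $G$ is an arbitrary function $v:G\to[0,\infty[$ (not assumed continuous, bounded, or strictly positive). Boundaries and closures are taken in $\mathbb{C}$. $H(G)$ is the space of holomorphic functions on $G$. $H^\infty_v(G):=\{f\in H(G) : \|f\|_v:=\sup_{z\in G} v(z)|f(z)|<+\infty\}$, endowed with the seminorm $\|\cdot\|_v$; saying it is a Banach space means that $\|\cdot\|_v$ is a norm and is complete. *)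

theory Defs
  imports
    "HOL-Complex_Analysis.Complex_Analysis"
    "HOL-Library.Function_Algebras"
begin

definition planar_domain :: "complex set \<Rightarrow> bool" where
  "planar_domain G \<longleftrightarrow> open G \<and> connected G \<and> G \<noteq> {}"

text \<open>Values of a weight outside \<open>G\<close> are irrelevant.\<close>

definition weight_on :: "complex set \<Rightarrow> (complex \<Rightarrow> real) \<Rightarrow> bool" where
  "weight_on G v \<longleftrightarrow> (\<forall>z\<in>G. 0 \<le> v z)"

definition fun_scale :: "complex \<Rightarrow> (complex \<Rightarrow> complex) \<Rightarrow> complex \<Rightarrow> complex" where
  "fun_scale c f = (\<lambda>z. c * f z)"

text \<open>
  A function on \<open>G\<close> is represented by its extension by zero to the whole plane, so that
  equality on \<open>G\<close> is equality and the pointwise operations of the full function type apply.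
\<close>

definition holomorphic_space :: "complex set \<Rightarrow> (complex \<Rightarrow> complex) set" where
  "holomorphic_space G = {f. f holomorphic_on G \<and> (\<forall>z. z \<notin> G \<longrightarrow> f z = 0)}"

text \<open>
  The supremum is taken in the reals, hence meaningful only when it is finite, that is,
  for members of the space \<open>Hv_infinity\<close> below (and nonempty \<open>G\<close>).
\<close>

definition weighted_sup_norm ::
  "complex set \<Rightarrow> (complex \<Rightarrow> real) \<Rightarrow> (complex \<Rightarrow> complex) \<Rightarrow> real" where
  "weighted_sup_norm G v f = (SUP z\<in>G. v z * cmod (f z))"

definition Hv_infinity ::
  "complex set \<Rightarrow> (complex \<Rightarrow> real) \<Rightarrow> (complex \<Rightarrow> complex) set" where
  "Hv_infinity G v =
     {f \<in> holomorphic_space G. bdd_above ((\<lambda>z. v z * cmod (f z)) ` G)}"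

text \<open>
  A linear subspace \<open>V\<close> that is a complex Banach space for \<open>N\<close>. Nothing is required of \<open>N\<close>
  outside \<open>V\<close>; in particular \<open>Metric_space\<close> is not used for completeness since it
  constrains the distance on the whole type.
\<close>

definition banach_space_on ::
  "(complex \<Rightarrow> 'a \<Rightarrow> 'a) \<Rightarrow> 'a::ab_group_add set \<Rightarrow> ('a \<Rightarrow> real) \<Rightarrow> bool" where
  "banach_space_on smul V N \<longleftrightarrow>
     vector_space smul \<and> module.subspace smul V \<and>
     (\<forall>x\<in>V. 0 \<le> N x) \<and>
     (\<forall>x\<in>V. N x = 0 \<longleftrightarrow> x = 0) \<and>
     (\<forall>c. \<forall>x\<in>V. N (smul c x) = cmod c * N x) \<and>
     (\<forall>x\<in>V. \<forall>y\<in>V. N (x + y) \<le> N x + N y) \<and>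
     (\<forall>X :: nat \<Rightarrow> 'a. range X \<subseteq> V \<longrightarrow>
        (\<forall>e>0. \<exists>M. \<forall>m\<ge>M. \<forall>n\<ge>M. N (X m - X n) < e) \<longrightarrow>
        (\<exists>x\<in>V. (\<lambda>n. N (X n - x)) \<longlonglongrightarrow> 0))"

end

theory Submission
  imports Defs
begin

text \<open>
  The hypothesis is what makes point evaluations continuous, locally uniformly on \<open>G\<close>. On the set
  where \<open>v \<ge> \<alpha>\<close> a function \<open>f\<close> of the space satisfies \<open>\<bar>f\<bar> \<le> \<parallel>f\<parallel> / \<alpha>\<close>. As \<open>f\<close> is continuous on
  \<open>G\<close>, this estimate passes to the points of \<open>G\<close> in the closure of that set, hence to the boundary
  of \<open>L\<close>, and the maximum modulus principle carries it into \<open>L \<supseteq> K\<close>. So every compact \<open>K \<subseteq> G\<close> has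
  a constant \<open>C\<close> with \<open>\<bar>f\<bar> \<le> C \<parallel>f\<parallel>\<close> on \<open>K\<close> for all \<open>f\<close> (lemma
  \<open>evaluation_bounded_on_compact\<close>).

  With singletons \<open>K\<close> this shows that only \<open>f = 0\<close> has \<open>\<parallel>f\<parallel> = 0\<close>. In general it shows that a
  Cauchy sequence is uniformly Cauchy on compact subsets of \<open>G\<close>, so that it has a holomorphic limit
  \<open>g\<close> by Weierstrass' theorem. The weighted estimates defining the Cauchy condition are pointwise
  and closed, so they survive the passage to the pointwise limit; they give both
  that \<open>g\<close> has finite norm and that the convergence holds in norm (lemma \<open>Hv_infinity_complete\<close>).
\<close>

text \<open>
  Continuity extends the bound from \<open>A\<close> to the boundary of \<open>L\<close>, the maximum modulus principle
  from there to \<open>L\<close>. \<open>A\<close> may lie outside \<open>L\<close>, which is why \<open>f\<close> has to live on the larger set \<open>G\<close>.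
\<close>

lemma norm_le_on_compact_of_frontier:
  fixes f :: "complex \<Rightarrow> complex"
  assumes hol: "f holomorphic_on G" and L: "compact L" "L \<subseteq> G"
    and front: "frontier L \<subseteq> closure A" and A: "A \<subseteq> G"
    and bound: "\<And>z. z \<in> A \<Longrightarrow> cmod (f z) \<le> B" and z: "z \<in> L"
  shows "cmod (f z) \<le> B"
proof (rule maximum_modulus_frontier[of f L])
  have contf: "continuous_on G f"
    using hol by (rule holomorphic_on_imp_continuous_on)
  show "f holomorphic_on interior L"
    using hol L(2) interior_subset by (meson holomorphic_on_subset order_trans)
  show "continuous_on (closure L) f"
    using contf L by (simp add: compact_imp_closed continuous_on_subset)
  show "bounded L"
    using L(1) by (rule compact_imp_bounded)
  show "z \<in> L"
    by (fact z)
  fix w assume w: "w \<in> frontier L"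
  then have "w \<in> G"
    using L compact_imp_closed frontier_subset_closed by blast
  obtain a where a: "\<And>n::nat. a n \<in> A" "a \<longlonglongrightarrow> w"
    using w front closure_sequential by blast
  have "(\<lambda>n. f (a n)) \<longlonglongrightarrow> f w"
    using a(1) A
    by (intro continuous_on_tendsto_compose[OF contf a(2) \<open>w \<in> G\<close>] always_eventually) blast
  then have "(\<lambda>n. cmod (f (a n))) \<longlonglongrightarrow> cmod (f w)"
    by (rule tendsto_norm)
  then show "cmod (f w) \<le> B"
    by (rule LIMSEQ_le_const2) (use a(1) bound in blast)
qed

lemma weighted_sup_norm_le_iff:
  assumes "G \<noteq> {}" "f \<in> Hv_infinity G v"
  shows "weighted_sup_norm G v f \<le> B \<longleftrightarrow> (\<forall>z\<in>G. v z * cmod (f z) \<le> B)"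
  using assms unfolding weighted_sup_norm_def Hv_infinity_def
  by (subst cSUP_le_iff) auto

lemma weighted_value_le_norm:
  assumes "f \<in> Hv_infinity G v" "z \<in> G"
  shows "v z * cmod (f z) \<le> weighted_sup_norm G v f"
  using assms unfolding weighted_sup_norm_def Hv_infinity_def
  by (auto intro: cSUP_upper)

lemma weighted_sup_norm_nonneg:
  assumes "weight_on G v" "G \<noteq> {}" "f \<in> Hv_infinity G v"
  shows "0 \<le> weighted_sup_norm G v f"
proof -
  obtain z where z: "z \<in> G"
    using assms(2) by blast
  then have "0 \<le> v z * cmod (f z)"
    using assms(1) by (simp add: weight_on_def)
  also have "\<dots> \<le> weighted_sup_norm G v f"
    using assms(3) z by (rule weighted_value_le_norm)
  finally show ?thesis .
qed

lemma Hv_infinityI: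
  assumes "f holomorphic_on G" "\<And>z. z \<notin> G \<Longrightarrow> f z = 0"
    "\<And>z. z \<in> G \<Longrightarrow> v z * cmod (f z) \<le> B"
  shows "f \<in> Hv_infinity G v"
  using assms by (auto simp: Hv_infinity_def holomorphic_space_def intro!: bdd_aboveI)

lemma Hv_infinityD:
  assumes "f \<in> Hv_infinity G v"
  shows "f holomorphic_on G" "\<And>z. z \<notin> G \<Longrightarrow> f z = 0"
  using assms by (auto simp: Hv_infinity_def holomorphic_space_def)

lemma weighted_add_le:
  assumes "weight_on G v" "z \<in> G" "v z * cmod a \<le> A" "v z * cmod b \<le> B"
  shows "v z * cmod (a + b) \<le> A + B"
proof -
  have "v z * cmod (a + b) \<le> v z * (cmod a + cmod b)"
    using assms(1,2) by (intro mult_left_mono norm_triangle_ineq) (auto simp: weight_on_def)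
  also have "\<dots> \<le> A + B"
    using assms(3,4) by (simp add: distrib_left)
  finally show ?thesis .
qed

lemma vector_space_fun_scale: "vector_space fun_scale"
  by unfold_locales (auto simp: fun_scale_def algebra_simps fun_eq_iff)

lemma Hv_infinity_zero: "0 \<in> Hv_infinity G v"
  by (rule Hv_infinityI[where B = 0]) (auto simp: zero_fun_def)

lemma Hv_infinity_add:
  assumes v: "weight_on G v" and f: "f \<in> Hv_infinity G v" and g: "g \<in> Hv_infinity G v"
  shows "f + g \<in> Hv_infinity G v"
proof (rule Hv_infinityI)
  show "f + g holomorphic_on G"
    using Hv_infinityD(1)[OF f] Hv_infinityD(1)[OF g]
    by (simp add: plus_fun_def holomorphic_on_add)
  show "(f + g) z = 0" if "z \<notin> G" for z
    using Hv_infinityD(2)[OF f that] Hv_infinityD(2)[OF g that] by simp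
  show "v z * cmod ((f + g) z) \<le> weighted_sup_norm G v f + weighted_sup_norm G v g"
    if "z \<in> G" for z
    using weighted_add_le[OF v that weighted_value_le_norm[OF f that] weighted_value_le_norm[OF g that]]
    by simp
qed

lemma Hv_infinity_scale:
  assumes f: "f \<in> Hv_infinity G v"
  shows "fun_scale c f \<in> Hv_infinity G v"
proof (rule Hv_infinityI)
  show "fun_scale c f holomorphic_on G"
    unfolding fun_scale_def using Hv_infinityD(1)[OF f] by (intro holomorphic_intros)
  show "fun_scale c f z = 0" if "z \<notin> G" for z
    using Hv_infinityD(2)[OF f that] by (simp add: fun_scale_def)
  show "v z * cmod (fun_scale c f z) \<le> cmod c * weighted_sup_norm G v f" if "z \<in> G" for z
    using mult_left_mono[OF weighted_value_le_norm[OF f that] norm_ge_zero[of c]]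
    by (simp add: fun_scale_def norm_mult mult.left_commute)
qed

lemma Hv_infinity_diff:
  assumes v: "weight_on G v" and f: "f \<in> Hv_infinity G v" and g: "g \<in> Hv_infinity G v"
  shows "f - g \<in> Hv_infinity G v"
proof -
  have "f - g = f + fun_scale (-1) g"
    by (auto simp: fun_scale_def)
  then show ?thesis
    using Hv_infinity_add[OF v f Hv_infinity_scale[OF g]] by metis
qed

lemma weighted_sup_norm_triangle:
  assumes "weight_on G v" "G \<noteq> {}" "f \<in> Hv_infinity G v" "g \<in> Hv_infinity G v"
  shows "weighted_sup_norm G v (f + g) \<le> weighted_sup_norm G v f + weighted_sup_norm G v g"
  using weighted_add_le[OF assms(1)] weighted_value_le_norm assms
  by (subst weighted_sup_norm_le_iff) (auto intro: Hv_infinity_add)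

text \<open>
  The inequality \<open>\<le>\<close> is pointwise; \<open>\<ge>\<close> is the same inequality for the factor \<open>1 / c\<close> and the
  function \<open>c f\<close>.
\<close>

lemma weighted_sup_norm_scale:
  assumes "G \<noteq> {}" and f: "f \<in> Hv_infinity G v"
  shows "weighted_sup_norm G v (fun_scale c f) = cmod c * weighted_sup_norm G v f"
proof -
  have le: "weighted_sup_norm G v (fun_scale d h) \<le> cmod d * weighted_sup_norm G v h"
    if h: "h \<in> Hv_infinity G v" for d h
    unfolding weighted_sup_norm_le_iff[OF assms(1) Hv_infinity_scale[OF h]]
  proof
    fix z assume "z \<in> G"
    from mult_left_mono[OF weighted_value_le_norm[OF h this] norm_ge_zero[of d]]
    show "v z * cmod (fun_scale d h z) \<le> cmod d * weighted_sup_norm G v h"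
      by (simp add: fun_scale_def norm_mult mult.left_commute)
  qed
  show ?thesis
  proof (cases "c = 0")
    case True
    then show ?thesis
      using assms(1) by (simp add: fun_scale_def weighted_sup_norm_def)
  next
    case False
    then have "fun_scale (inverse c) (fun_scale c f) = f"
      by (simp add: fun_scale_def flip: mult.assoc)
    then have "weighted_sup_norm G v f \<le> cmod (inverse c) * weighted_sup_norm G v (fun_scale c f)"
      using le[OF Hv_infinity_scale[OF f], of "inverse c" c] by simp
    then have "cmod c * weighted_sup_norm G v f \<le> weighted_sup_norm G v (fun_scale c f)"
      using False by (simp add: norm_inverse norm_divide field_simps)
    with le[OF f, of c] show ?thesis
      by simp
  qed
qed

text \<open>
  The factor is \<open>1 / \<alpha>\<close>, the estimate that holds outright where \<open>v \<ge> \<alpha>\<close>. That it depends on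
  \<open>K\<close> only, and not on \<open>f\<close>, is what yields uniform convergence later.
\<close>

lemma evaluation_bounded_on_compact:
  assumes L: "compact L" "K \<subseteq> L" "L \<subseteq> G" and \<alpha>: "\<alpha> > 0"
    and front: "frontier L \<subseteq> closure {z \<in> G. v z \<ge> \<alpha>}"
    and f: "f \<in> Hv_infinity G v" and z: "z \<in> K"
  shows "cmod (f z) \<le> (1 / \<alpha>) * weighted_sup_norm G v f"
proof (rule norm_le_on_compact_of_frontier[OF Hv_infinityD(1)[OF f] L(1,3) front])
  show "z \<in> L"
    using z L(2) by blast
  fix w assume w: "w \<in> {z \<in> G. v z \<ge> \<alpha>}"
  then have "\<alpha> * cmod (f w) \<le> v w * cmod (f w)"
    by (intro mult_right_mono) auto
  also have "\<dots> \<le> weighted_sup_norm G v f"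
    using weighted_value_le_norm[OF f] w by blast
  finally show "cmod (f w) \<le> (1 / \<alpha>) * weighted_sup_norm G v f"
    using \<alpha> by (simp add: field_simps)
qed auto

text \<open>
  Assumption \<open>eval\<close> turns the Cauchy condition for the norm into the uniform one on compact sets,
  which makes the limit holomorphic. Convergence in norm needs a separate argument: \<open>v\<close> may be
  unbounded on compact sets, so locally uniform convergence says nothing about the weighted
  differences, and these are controlled by the Cauchy estimate itself.
\<close>

lemma Hv_infinity_complete:
  assumes G: "open G" "G \<noteq> {}" and v: "weight_on G v"
    and eval: "\<And>K. compact K \<Longrightarrow> K \<subseteq> G \<Longrightarrow>
      \<exists>C>0. \<forall>f\<in>Hv_infinity G v. \<forall>z\<in>K. cmod (f z) \<le> C * weighted_sup_norm G v f"
    and X: "\<And>n::nat. X n \<in> Hv_infinity G v"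
    and Cauchy: "\<And>e. e > 0 \<Longrightarrow> \<exists>M. \<forall>m\<ge>M. \<forall>n\<ge>M. weighted_sup_norm G v (X m - X n) < e"
  shows "\<exists>g\<in>Hv_infinity G v. (\<lambda>n. weighted_sup_norm G v (X n - g)) \<longlonglongrightarrow> 0"
proof -
  have diff: "X m - X n \<in> Hv_infinity G v" for m n
    using Hv_infinity_diff[OF v X X] .
  have ucauchy: "uniformly_Cauchy_on K X" if K: "compact K" "K \<subseteq> G" for K
  proof (rule uniformly_Cauchy_onI)
    fix e :: real assume "e > 0"
    obtain C where C: "C > 0"
      "\<And>f z. f \<in> Hv_infinity G v \<Longrightarrow> z \<in> K \<Longrightarrow> cmod (f z) \<le> C * weighted_sup_norm G v f"
      using eval[OF K] by blast
    obtain M where M: "\<And>m n. m \<ge> M \<Longrightarrow> n \<ge> M \<Longrightarrow> weighted_sup_norm G v (X m - X n) < e / C"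
      using Cauchy[of "e / C"] \<open>e > 0\<close> C(1) by auto
    have "dist (X m z) (X n z) < e" if "z \<in> K" "m \<ge> M" "n \<ge> M" for z m n
    proof -
      have "dist (X m z) (X n z) \<le> C * weighted_sup_norm G v (X m - X n)"
        using C(2)[OF diff that(1), of m n] by (simp add: dist_norm)
      also have "\<dots> < C * (e / C)"
        using M[OF that(2,3)] C(1) by (rule mult_strict_left_mono)
      finally show ?thesis
        using C(1) by simp
    qed
    then show "\<exists>M. \<forall>z\<in>K. \<forall>m\<ge>M. \<forall>n\<ge>M. dist (X m z) (X n z) < e"
      by blast
  qed
  define g where "g = (\<lambda>z. lim (\<lambda>n. X n z))"
  have unif: "uniform_limit K X g sequentially" if K: "compact K" "K \<subseteq> G" for K
    unfolding g_def using Cauchy_uniformly_convergent[OF ucauchy[OF K]]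
      uniformly_convergent_uniform_limit_iff by blast
  have lim: "(\<lambda>n. X n z) \<longlonglongrightarrow> g z" if "z \<in> G" for z
    using tendsto_uniform_limitI[OF unif[of "{z}"]] that by auto
  have g_out: "g z = 0" if "z \<notin> G" for z
    using Hv_infinityD(2)[OF X that] by (simp add: g_def)
  have g_hol: "g holomorphic_on G"
  proof (rule holomorphic_uniform_sequence[OF G(1)])
    show "X n holomorphic_on G" for n
      using Hv_infinityD(1)[OF X] .
    fix z assume "z \<in> G"
    then obtain d where "d > 0" "cball z d \<subseteq> G"
      using G(1) open_contains_cball by blast
    then show "\<exists>d>0. cball z d \<subseteq> G \<and> uniform_limit (cball z d) X g sequentially"
      using unif[of "cball z d"] by auto
  qed
  \<comment> \<open>Letting only the second index of the Cauchy estimate tend to infinity, at a fixed point.\<close>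
  have close: "\<exists>M. \<forall>n\<ge>M. \<forall>z\<in>G. v z * cmod (X n z - g z) \<le> e" if e: "e > 0" for e
  proof -
    obtain M where M: "\<And>m n. m \<ge> M \<Longrightarrow> n \<ge> M \<Longrightarrow> weighted_sup_norm G v (X m - X n) < e"
      using Cauchy[OF e] by blast
    have "v z * cmod (X n z - g z) \<le> e" if n: "n \<ge> M" and z: "z \<in> G" for n z
    proof (rule LIMSEQ_le_const2)
      show "(\<lambda>m. v z * cmod (X n z - X m z)) \<longlonglongrightarrow> v z * cmod (X n z - g z)"
        by (intro tendsto_intros lim z)
      have "v z * cmod (X n z - X m z) \<le> e" if "m \<ge> M" for m
        using weighted_value_le_norm[OF diff z, of n m] M[OF n that] by simp
      then show "\<exists>N. \<forall>m\<ge>N. v z * cmod (X n z - X m z) \<le> e"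
        by blast
    qed
    then show ?thesis
      by blast
  qed
  have g: "g \<in> Hv_infinity G v"
  proof -
    obtain n where n: "\<And>z. z \<in> G \<Longrightarrow> v z * cmod (X n z - g z) \<le> 1"
      using close[of 1] by auto
    show ?thesis
    proof (rule Hv_infinityI[OF g_hol g_out])
      fix z assume z: "z \<in> G"
      have "v z * cmod (g z - X n z) \<le> 1"
        using n[OF z] by (simp add: norm_minus_commute)
      from weighted_add_le[OF v z this weighted_value_le_norm[OF X[of n] z]]
      show "v z * cmod (g z) \<le> 1 + weighted_sup_norm G v (X n)"
        by simp
    qed
  qed
  have "(\<lambda>n. weighted_sup_norm G v (X n - g)) \<longlonglongrightarrow> 0"
  proof (rule LIMSEQ_I)
    fix e :: real assume e: "e > 0"
    then obtain M where M: "\<And>n z. n \<ge> M \<Longrightarrow> z \<in> G \<Longrightarrow> v z * cmod (X n z - g z) \<le> e / 2"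
      using close[of "e / 2"] by auto
    have "norm (weighted_sup_norm G v (X n - g) - 0) < e" if n: "n \<ge> M" for n
    proof -
      have Xg: "X n - g \<in> Hv_infinity G v"
        using Hv_infinity_diff[OF v X g] .
      have "weighted_sup_norm G v (X n - g) \<le> e / 2"
        unfolding weighted_sup_norm_le_iff[OF G(2) Xg] using M[OF n] by simp
      with weighted_sup_norm_nonneg[OF v G(2) Xg] e show ?thesis
        by simp
    qed
    then show "\<exists>M. \<forall>n\<ge>M. norm (weighted_sup_norm G v (X n - g) - 0) < e"
      by blast
  qed
  with g show ?thesis
    by blast
qed

theorem proposition3p12:
  fixes G :: "complex set" and v :: "complex \<Rightarrow> real"
  assumes "planar_domain G"
    and "weight_on G v"
    and "\<And>K. compact K \<Longrightarrow> K \<subseteq> G \<Longrightarrow>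
           \<exists>L \<alpha>. compact L \<and> K \<subseteq> L \<and> L \<subseteq> G \<and> \<alpha> > 0 \<and>
                 frontier L \<subseteq> closure {z \<in> G. v z \<ge> \<alpha>}"
  shows "banach_space_on fun_scale (Hv_infinity G v) (weighted_sup_norm G v)"
proof -
  have G: "open G" "G \<noteq> {}"
    using assms(1) by (auto simp: planar_domain_def)
  note v = assms(2)
  have eval: "\<exists>C>0. \<forall>f\<in>Hv_infinity G v. \<forall>z\<in>K. cmod (f z) \<le> C * weighted_sup_norm G v f"
    if K: "compact K" "K \<subseteq> G" for K
  proof -
    obtain L \<alpha> where L: "compact L" "K \<subseteq> L" "L \<subseteq> G" and \<alpha>: "\<alpha> > 0"
      and front: "frontier L \<subseteq> closure {z \<in> G. v z \<ge> \<alpha>}"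
      using assms(3)[OF K] by blast
    have "\<forall>f\<in>Hv_infinity G v. \<forall>z\<in>K. cmod (f z) \<le> (1 / \<alpha>) * weighted_sup_norm G v f"
      using evaluation_bounded_on_compact[OF L \<alpha> front] by blast
    moreover have "1 / \<alpha> > 0"
      using \<alpha> by simp
    ultimately show ?thesis
      by blast
  qed
  have subspace: "module.subspace fun_scale (Hv_infinity G v)"
  proof -
    interpret vector_space fun_scale
      by (rule vector_space_fun_scale)
    show ?thesis
      by (intro subspaceI Hv_infinity_zero Hv_infinity_add[OF v] Hv_infinity_scale)
  qed
  have definite: "weighted_sup_norm G v f = 0 \<longleftrightarrow> f = 0" if f: "f \<in> Hv_infinity G v" for f
  proof
    assume N: "weighted_sup_norm G v f = 0"
    show "f = 0"
    proof
      fix z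
      show "f z = 0 z"
      proof (cases "z \<in> G")
        case True
        then show ?thesis
          using eval[of "{z}"] f N by fastforce
      next
        case False
        then show ?thesis
          using Hv_infinityD(2)[OF f] by simp
      qed
    qed
  next
    assume "f = 0"
    then show "weighted_sup_norm G v f = 0"
      using G(2) by (simp add: weighted_sup_norm_def)
  qed
  show ?thesis
    unfolding banach_space_on_def
  proof (intro conjI ballI allI impI)
    fix X :: "nat \<Rightarrow> complex \<Rightarrow> complex"
    assume "range X \<subseteq> Hv_infinity G v"
      and "\<forall>e>0. \<exists>M. \<forall>m\<ge>M. \<forall>n\<ge>M. weighted_sup_norm G v (X m - X n) < e"
    then show "\<exists>g\<in>Hv_infinity G v. (\<lambda>n. weighted_sup_norm G v (X n - g)) \<longlonglongrightarrow> 0"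
      by (intro Hv_infinity_complete[OF G v eval]) auto
  qed (use vector_space_fun_scale subspace definite weighted_sup_norm_nonneg[OF v G(2)]
        weighted_sup_norm_scale[OF G(2)] weighted_sup_norm_triangle[OF v G(2)] in auto)
qed

end
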